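(* For every $\pi\in\mathfrak{B}_n$, $$\sum_{j,k\ge 0}\binom{2jk+j+2k+n-\mathrm{des}_A(\pi)}{n}s^jt^k=\frac{\sum_{\sigma\tau=\pi}s^{\mathrm{des}_A(\sigma)}t^{\mathrm{des}_B(\tau)}}{(1-s)^{n+1}(1-t)^{n+1}}$$ and $$\sum_{j,k\ge 0}\binom{2jk+2j+k+n-\mathrm{des}_A(\pi)}{n}s^jt^k=\frac{\sum_{\sigma\tau=\pi}s^{\mathrm{des}_B(\sigma)}t^{\mathrm{des}_A(\tau)}}{(1-s)^{n+1}(1-t)^{n+1}},$$ where the sums on the right are over all pairs $(\sigma,\tau)\in\mathfrak{B}_n\times\mathfrak{B}_n$ with $\sigma\tau=\pi$.
   Context: Let $n\ge 1$. The hyperoctahedral group $\mathfrak{B}_n$ is the group (under composition of functions, $(\sigma\tau)(i)=\sigma(\tau(i))$) of all bijections $\pi$ of $\{-n,\ldots,-1,0,1,\ldots,n\}$ with $\pi(-i)=-\pi(i)$ for all $i$. For $\pi\in\mathfrak{B}_n$, $\mathrm{des}_A(\pi)=|\{i\in\{1,\ldots,n-1\}:\pi(i)>\pi(i+1)\}|$ and $\mathrm{des}_B(\pi)=|\{i\in\{0,\ldots,n-1\}:\pi(i)>\pi(i+1)\}|$ (with $\pi(0)=0$). The identities are of formal power series in $s,t$. *)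

theory Defs
  imports
    "HOL-Computational_Algebra.Formal_Power_Series"
    "HOL-Combinatorics.Permutations"
begin

unbundle fps_syntax

text \<open>
  A bijection of \<open>{-n..n}\<close> is represented by its extension to all integers by the identity
  (this is what \<open>permutes\<close> says), so that distinct group elements are distinct functions
  and the group operation is \<open>\<sigma> \<circ> \<tau>\<close>.
\<close>

definition hyperoctahedral :: "nat \<Rightarrow> (int \<Rightarrow> int) set" where
  "hyperoctahedral n =
     {\<pi>. \<pi> permutes {- int n..int n} \<and> (\<forall>i\<in>{- int n..int n}. \<pi> (- i) = - \<pi> i)}"

definition des_A :: "nat \<Rightarrow> (int \<Rightarrow> int) \<Rightarrow> nat" where
  "des_A n \<pi> = card {i \<in> {1..int n - 1}. \<pi> i > \<pi> (i + 1)}"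

definition des_B :: "nat \<Rightarrow> (int \<Rightarrow> int) \<Rightarrow> nat" where
  "des_B n \<pi> = card {i \<in> {0..int n - 1}. \<pi> i > \<pi> (i + 1)}"

definition factorizations :: "nat \<Rightarrow> (int \<Rightarrow> int) \<Rightarrow> ((int \<Rightarrow> int) \<times> (int \<Rightarrow> int)) set" where
  "factorizations n \<pi> =
     {(\<sigma>, \<tau>). \<sigma> \<in> hyperoctahedral n \<and> \<tau> \<in> hyperoctahedral n \<and> \<sigma> \<circ> \<tau> = \<pi>}"

text \<open>
  Bivariate series are series in \<open>s\<close> whose coefficients are series in \<open>t\<close>:
  the coefficient of \<open>s\<^sup>j t\<^sup>k\<close> in \<open>F\<close> is \<open>F $ j $ k\<close>. The double sum of \<open>c j k * s^j * t^k\<close>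
  over all \<open>j\<close> and \<open>k\<close> is given by its coefficients, not by \<open>suminf\<close>, since the
  library topology on \<open>'a fps fps\<close> is discrete on the coefficients, which are themselves series.
\<close>

definition var_s :: "rat fps fps" where
  "var_s = fps_X"

definition var_t :: "rat fps fps" where
  "var_t = fps_const fps_X"

definition double_series :: "(nat \<Rightarrow> nat \<Rightarrow> rat) \<Rightarrow> rat fps fps" where
  "double_series c = Abs_fps (\<lambda>j. Abs_fps (\<lambda>k. c j k))"

lemma double_series_nth: "double_series c $ j $ k = c j k"
  by (simp add: double_series_def)

lemma var_s_var_t_power_nth:
  "(var_s ^ a * var_t ^ b) $ j $ k = (if j = a \<and> k = b then 1 else 0)"
  by (simp add: var_s_def var_t_def fps_X_power_mult_nth fps_const_power fps_X_power_nth)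

text \<open>The natural-number subtraction in the binomial coefficients never truncates.\<close>

lemma des_A_le: "des_A n \<pi> \<le> n"
proof -
  have "des_A n \<pi> \<le> card {1..int n - 1}"
    unfolding des_A_def by (rule card_mono) auto
  then show ?thesis by simp
qed

lemma finite_factorizations: "finite (factorizations n \<pi>)"
proof (rule finite_subset)
  show "factorizations n \<pi> \<subseteq> {p. p permutes {- int n..int n}} \<times> {p. p permutes {- int n..int n}}"
    by (auto simp: factorizations_def hyperoctahedral_def)
  show "finite ({p. p permutes {- int n..int n}} \<times> {p. p permutes {- int n..int n}})"
    by (intro finite_cartesian_product finite_permutations) auto
qed

text \<open>Division of bivariate series by the denominator is genuine division.\<close>

lemma divide_denominator_cancel:
  fixes F :: "rat fps fps" and m :: nat
  defines "D \<equiv> (1 - var_s) ^ m * (1 - var_t) ^ m"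
  shows "F / D * D = F"
proof -
  have D0: "D $ 0 = (1 - fps_X) ^ m"
    by (simp add: D_def var_s_def var_t_def fps_power_zeroth)
  have D00: "D $ 0 $ 0 = 1"
    by (simp add: D0 fps_power_zeroth)
  then have "D $ 0 \<noteq> 0" by auto
  then have sub: "subdegree D = 0" by (simp add: subdegree_eq_0)
  have "D $ 0 * inverse (D $ 0) = 1"
    using D00 by (intro inverse_mult_eq_1') simp
  then have inv: "D * inverse D = 1"
    unfolding fps_inverse_def by (rule fps_right_inverse)
  have "F / D = F * inverse D"
    by (simp add: fps_divide_def sub)
  then show ?thesis using inv by (simp add: mult.assoc mult.commute[of _ D])
qed

end

theory Submission
  imports Defs
begin

text \<open>
  Comparing coefficients, the first identity says that \<open>(N + n - des_A \<pi>) choose n\<close> with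
  \<open>N + 1 = (2k + 1)(j + 1)\<close> is the sum over \<open>\<sigma>\<tau> = \<pi>\<close> of
  \<open>((j + n - des_A \<sigma>) choose n) ((k + n - des_B \<tau>) choose n)\<close>.
  Each binomial coefficient counts odd functions \<open>F\<close> on \<open>{-n..n}\<close> for which the pairs \<open>(F i, w i)\<close>
  increase lexicographically: values in \<open>{-m..m}\<close> give \<open>des_B w\<close>, and odd values of absolute value
  at most \<open>2m + 1\<close> give \<open>des_A w\<close>, because then \<open>F 1 > 0 = F 0\<close> makes a descent at 0 harmless.

  If \<open>a\<close> is such a function for \<open>\<sigma>\<close> and \<open>b\<close> one for \<open>\<tau>\<close>, the triples \<open>(b i, a (\<tau> i), \<pi> i)\<close>
  increase lexicographically, and \<open>\<tau>\<close> is recovered as the signed permutation that ranks the pairs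
  \<open>(a (\<tau> i), \<pi> i)\<close>. A linear combination \<open>p b + q (a \<circ> \<tau>)\<close> encodes the pair of values as an odd
  number, so the pairs are in turn counted by a binomial coefficient for \<open>\<pi>\<close>. The second
  identity exchanges the roles of the two value sets.
\<close>

section \<open>Generating functions of binomial coefficients\<close>

text \<open>By Pascal's rule, multiplication by \<open>1 - fps_X\<close> takes differences of the
  coefficients and so lowers \<open>m\<close> by one.\<close>

lemma fps_choose_mult:
  "Abs_fps (\<lambda>j. of_nat (j + m choose m) :: 'a::comm_ring_1) * (1 - fps_X) ^ (m + 1) = 1"
proof (induction m)
  case 0
  show ?case
    by (rule fps_ext) (simp add: right_diff_distrib fps_mult_fps_X_commute)
next
  case (Suc m)
  have "Abs_fps (\<lambda>j. of_nat (j + Suc m choose Suc m) :: 'a) * (1 - fps_X)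
      = Abs_fps (\<lambda>j. of_nat (j + m choose m))"
  proof (rule fps_ext)
    fix j
    show "(Abs_fps (\<lambda>j. of_nat (j + Suc m choose Suc m) :: 'a) * (1 - fps_X)) $ j
        = Abs_fps (\<lambda>j. of_nat (j + m choose m)) $ j"
      by (cases j) (simp_all add: right_diff_distrib binomial_eq_0)
  qed
  then show ?case
    using Suc by (simp add: mult.assoc[symmetric])
qed

text \<open>For \<open>j < a\<close> the upper index \<open>j + n - a\<close> lies below
  \<open>n\<close>, so these coefficients vanish and the factor \<open>fps_X ^ a\<close> splits
  off.\<close>

lemma fps_choose_shift_mult:
  assumes "a \<le> n"
  shows "Abs_fps (\<lambda>j. of_nat (j + n - a choose n) :: 'a::comm_ring_1) * (1 - fps_X) ^ (n + 1)
    = fps_X ^ a"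
proof -
  have "Abs_fps (\<lambda>j. of_nat (j + n - a choose n) :: 'a)
      = fps_X ^ a * Abs_fps (\<lambda>j. of_nat (j + n choose n))"
    using assms by (intro fps_ext) (auto simp: fps_X_power_mult_nth binomial_eq_0)
  then show ?thesis
    using fps_choose_mult[of n, where 'a = 'a] by (simp add: mult.assoc del: power_Suc)
qed

text \<open>Bivariate series form an integral domain, so the nonzero denominator cancels.\<close>

lemma eq_divide_denominator:
  assumes "G * ((1 - var_s) ^ m * (1 - var_t) ^ m) = F"
  shows "G = F / ((1 - var_s) ^ m * (1 - var_t) ^ m)"
proof -
  have "(1 - var_s) $ 0 $ 0 \<noteq> 0" "(1 - var_t) $ 0 $ 0 \<noteq> 0"
    by (simp_all add: var_s_def var_t_def)
  then have "1 - var_s \<noteq> 0" "1 - var_t \<noteq> 0"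
    by (metis fps_zero_nth)+
  then show ?thesis
    using divide_denominator_cancel[of F m] assms by (metis mult_cancel_right mult_eq_0_iff power_not_zero)
qed

text \<open>Each summand is a product of a series in \<open>s\<close> and a series in
  \<open>t\<close>, and \<open>fps_choose_shift_mult\<close> evaluates both factors. This reduces
  either identity of the theorem to one between coefficients.\<close>

lemma double_series_eq_divide:
  assumes "finite A" and "\<And>x. x \<in> A \<Longrightarrow> u x \<le> n" "\<And>x. x \<in> A \<Longrightarrow> v x \<le> n"
    and "\<And>j k. c j k = (\<Sum>x\<in>A. of_nat (j + n - u x choose n) * of_nat (k + n - v x choose n))"
  shows "double_series c
    = (\<Sum>x\<in>A. var_s ^ u x * var_t ^ v x) / ((1 - var_s) ^ (n + 1) * (1 - var_t) ^ (n + 1))"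
proof (rule eq_divide_denominator)
  define U where "U x = (Abs_fps (\<lambda>j. of_nat (j + n - u x choose n)) :: rat fps fps)" for x
  define V where "V x = (Abs_fps (\<lambda>j. of_nat (j + n - v x choose n)) :: rat fps)" for x
  have "double_series c = (\<Sum>x\<in>A. U x * fps_const (V x))"
    by (intro fps_ext)
      (simp add: double_series_nth assms(4) fps_sum_nth U_def V_def fps_of_nat[symmetric])
  also have "\<dots> * ((1 - var_s) ^ (n + 1) * (1 - var_t) ^ (n + 1))
      = (\<Sum>x\<in>A. (U x * (1 - fps_X) ^ (n + 1)) * fps_const (V x * (1 - fps_X) ^ (n + 1)))"
  proof -
    \<comment> \<open>As a series in \<open>s\<close>, \<open>1 - var_t\<close> is constant, so its
      power can be moved inside \<open>fps_const\<close>.\<close>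
    have "(1 - var_t) ^ (n + 1) = fps_const ((1 - fps_X) ^ (n + 1))"
      unfolding var_t_def fps_const_power[symmetric] by (simp flip: fps_const_1_eq_1 fps_const_sub)
    then show ?thesis
      unfolding var_s_def sum_distrib_right fps_const_mult[symmetric]
      by (intro sum.cong) (simp_all only: ac_simps)
  qed
  also have "\<dots> = (\<Sum>x\<in>A. var_s ^ u x * var_t ^ v x)"
    unfolding U_def V_def var_s_def var_t_def
    by (intro sum.cong refl)
      (simp only: fps_choose_shift_mult assms(2,3) fps_const_power)
  finally show "double_series c * ((1 - var_s) ^ (n + 1) * (1 - var_t) ^ (n + 1))
      = (\<Sum>x\<in>A. var_s ^ u x * var_t ^ v x)" .
qed

section \<open>Increasing sequences with prescribed strict steps\<close>

text \<open>The value 0 outside \<open>{1..n}\<close> includes \<open>c 0 = 0\<close>, so the condition at \<open>i = 0\<close> bounds \<open>c 1\<close> below.\<close>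

definition bounded_seqs :: "nat \<Rightarrow> int \<Rightarrow> (int \<Rightarrow> bool) \<Rightarrow> (int \<Rightarrow> int) set" where
  "bounded_seqs n N Q = {c. (\<forall>i. i \<notin> {1..int n} \<longrightarrow> c i = 0) \<and> c (int n) \<le> N \<and>
     (\<forall>i\<in>{0..<int n}. c i < c (i + 1) \<or> c i = c (i + 1) \<and> Q i)}"

lemma bounded_seqs_mono:
  assumes "c \<in> bounded_seqs n N Q" "0 \<le> i" "i \<le> j" "j \<le> int n"
  shows "c i \<le> c j"
  using assms(3,4)
proof (induction j rule: int_ge_induct)
  case (step j)
  then have "c j < c (j + 1) \<or> c j = c (j + 1)"
    using assms(1,2) by (auto simp: bounded_seqs_def)
  then show ?case using step by auto
qed simp

lemma bounded_seqs_bounds: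
  assumes "c \<in> bounded_seqs n N Q" "0 \<le> i" "i \<le> int n"
  shows "0 \<le> c i" "c i \<le> N"
  using bounded_seqs_mono[OF assms(1), of 0 i] bounded_seqs_mono[OF assms(1), of i "int n"] assms
  by (auto simp: bounded_seqs_def)

text \<open>The hockey-stick identity: each new summand is absorbed by Pascal's rule.\<close>

lemma sum_choose_shift:
  assumes "d \<le> n"
  shows "(\<Sum>m<v. m + n - d choose n) = v + n - d choose Suc n"
proof (induction v)
  case 0
  show ?case by simp
next
  case (Suc v)
  have "Suc v + n - d = Suc (v + n - d)" using assms by simp
  then show ?case using Suc by simp
qed

text \<open>The sequences are sorted by their last value \<open>m\<close>. If \<open>Q n\<close>
  fails, the last step is strict and the bound for the rest drops to \<open>m - 1\<close>; this is
  -1 for \<open>m = 0\<close>, so bounds are integers.\<close>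

lemma bounded_seqs_Suc:
  "bounded_seqs (Suc n) (int N) Q = (\<Union>m\<in>{..N}. (\<lambda>c. c(int n + 1 := int m)) `
      bounded_seqs n (if Q (int n) then int m else int m - 1) Q)" (is "?L = ?R")
proof (intro equalityI subsetI)
  fix c assume c: "c \<in> ?L"
  define m where "m = nat (c (int n + 1))"
  have m: "int m = c (int n + 1)" "m \<le> N"
    using bounded_seqs_bounds[OF c, of "int n + 1"] by (auto simp: m_def)
  have last: "c (int n) < c (int n + 1) \<or> c (int n) = c (int n + 1) \<and> Q (int n)"
    using c by (auto simp: bounded_seqs_def)
  have z: "c i = 0" if "i \<notin> {1..int n + 1}" for i
    using c that by (auto simp: bounded_seqs_def)
  have st: "c i < c (i + 1) \<or> c i = c (i + 1) \<and> Q i" if "0 \<le> i" "i < int n" for i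
    using c that by (auto simp: bounded_seqs_def)
  \<comment> \<open>Position \<open>n + 1\<close> lies outside the shorter range and takes the
    default value 0 there.\<close>
  have "c(int n + 1 := 0) \<in> bounded_seqs n (if Q (int n) then int m else int m - 1) Q"
    using last m(1) z st by (auto simp: bounded_seqs_def)
  moreover have "c = (c(int n + 1 := 0))(int n + 1 := int m)"
    using m by simp
  ultimately show "c \<in> ?R" using m by blast
next
  fix c assume "c \<in> ?R"
  then obtain m c' where m: "m \<le> N" "c' \<in> bounded_seqs n (if Q (int n) then int m else int m - 1) Q"
    "c = c'(int n + 1 := int m)" by auto
  have z: "c' i = 0" if "i \<notin> {1..int n}" for i
    using m that by (auto simp: bounded_seqs_def)
  have st: "c' i < c' (i + 1) \<or> c' i = c' (i + 1) \<and> Q i" if "0 \<le> i" "i < int n" for i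
    using m that by (auto simp: bounded_seqs_def)
  have last: "c' (int n) \<le> (if Q (int n) then int m else int m - 1)"
    using m by (auto simp: bounded_seqs_def)
  have "c i < c (i + 1) \<or> c i = c (i + 1) \<and> Q i" if "0 \<le> i" "i < int n + 1" for i
    using st[of i] last that by (cases "i = int n") (auto simp: m split: if_splits)
  then show "c \<in> ?L"
    using m(1) z by (auto simp: bounded_seqs_def m(3))
qed

text \<open>Induction on \<open>n\<close>, summing over the last value. A negative bound excludes
  every sequence because \<open>c 0 = 0\<close>; the binomial formula would miss this for
  \<open>n = 0\<close>.\<close>

lemma card_bounded_seqs:
  "finite (bounded_seqs n N Q) \<and> card (bounded_seqs n N Q)
    = (if N < 0 then 0 else nat N + n - card {i \<in> {0..<int n}. \<not> Q i} choose n)"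
proof (induction n arbitrary: N)
  case 0
  have "bounded_seqs 0 N Q = (if N < 0 then {} else {\<lambda>_. 0})"
    by (auto simp: bounded_seqs_def)
  then show ?case by simp
next
  case (Suc n)
  show ?case
  proof (cases "N < 0")
    case True
    then have "bounded_seqs (Suc n) N Q = {}"
      using bounded_seqs_bounds[of _ "Suc n" N Q 0] by fastforce
    then show ?thesis using True by simp
  next
    case False
    define M where "M = nat N"
    have N: "N = int M" using False by (simp add: M_def)
    define d where "d = card {i \<in> {0..<int n}. \<not> Q i}"
    have "d \<le> card {0..<int n}"
      unfolding d_def by (rule card_mono) auto
    then have d: "d \<le> n" by simp
    define B where "B m = bounded_seqs n (if Q (int n) then int m else int m - 1) Q" for m
    define U where "U m = (\<lambda>c. c(int n + 1 := int m)) ` B m" for m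
    have eq: "bounded_seqs (Suc n) N Q = (\<Union>m\<in>{..M}. U m)"
      unfolding N U_def B_def by (rule bounded_seqs_Suc)
    have finB: "finite (B m)" for m
      using Suc by (simp add: B_def)
    have "inj_on (\<lambda>c. c(int n + 1 := int m)) (B m)" for m
    proof (rule inj_onI)
      fix c c' assume c: "c \<in> B m" "c' \<in> B m" and e: "c(int n + 1 := int m) = c'(int n + 1 := int m)"
      have "c i = c' i" for i
        using fun_cong[OF e, of i] c by (cases "i = int n + 1") (auto simp: B_def bounded_seqs_def)
      then show "c = c'" by blast
    qed
    then have cU: "card (U m) = card (B m)" for m
      by (simp add: U_def card_image)
    have finU: "finite (U m)" for m
      using finB by (simp add: U_def)
    have disj: "U m \<inter> U m' = {}" if "m \<noteq> m'" for m m'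
    proof -
      have "c (int n + 1) = int m" if "c \<in> U m" for c m
        using that by (auto simp: U_def)
      then show ?thesis using that by (metis disjoint_iff of_nat_eq_iff)
    qed
    have "card (bounded_seqs (Suc n) N Q) = (\<Sum>m\<le>M. card (B m))"
      unfolding eq cU[symmetric] by (rule card_UN_disjoint) (use finU disj in auto)
    also have "\<dots> = M + Suc n - card {i \<in> {0..<int (Suc n)}. \<not> Q i} choose Suc n"
    proof (cases "Q (int n)")
      case True
      have "{i \<in> {0..<int (Suc n)}. \<not> Q i} = {i \<in> {0..<int n}. \<not> Q i}"
        using True by (auto simp: less_le)
      moreover have "(\<Sum>m\<le>M. card (B m)) = (\<Sum>m<Suc M. m + n - d choose n)"
        using True Suc by (simp add: B_def d_def lessThan_Suc_atMost)
      ultimately show ?thesis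
        using sum_choose_shift[OF d, of "Suc M"] by (simp add: d_def)
    next
      case False
      have "{i \<in> {0..<int (Suc n)}. \<not> Q i} = insert (int n) {i \<in> {0..<int n}. \<not> Q i}"
        using False by auto
      moreover have "finite {i \<in> {0..<int n}. \<not> Q i}"
        by (rule finite_subset[of _ "{0..<int n}"]) auto
      ultimately have "card {i \<in> {0..<int (Suc n)}. \<not> Q i} = Suc d"
        by (simp add: d_def)
      moreover have "(\<Sum>m\<le>M. card (B m)) = (\<Sum>m<M. m + n - d choose n)"
      proof -
        have "(\<Sum>m\<le>M. card (B m)) = (\<Sum>m<Suc M. card (B m))"
          by (simp add: lessThan_Suc_atMost)
        \<comment> \<open>\<open>B 0\<close> has the upper bound -1 and is empty, so a strict last
          step shifts the summation index by one.\<close>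
        also have "\<dots> = card (B 0) + (\<Sum>m<M. card (B (Suc m)))"
          by (rule sum.lessThan_Suc_shift)
        finally show ?thesis
          using False Suc by (simp add: B_def d_def)
      qed
      ultimately show ?thesis
        using sum_choose_shift[OF d, of M] by simp
    qed
    finally have "card (bounded_seqs (Suc n) N Q)
        = M + Suc n - card {i \<in> {0..<int (Suc n)}. \<not> Q i} choose Suc n" .
    moreover have "finite (bounded_seqs (Suc n) N Q)"
      unfolding eq using finU by simp
    ultimately show ?thesis using False by (simp add: M_def)
  qed
qed

section \<open>Signed permutations and standardization\<close>

lemma hyperoctahedral_permutes: "w \<in> hyperoctahedral n \<Longrightarrow> w permutes {- int n..int n}"
  by (simp add: hyperoctahedral_def)

lemma hyperoctahedral_minus:
  assumes "w \<in> hyperoctahedral n"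
  shows "w (- i) = - w i"
proof (cases "i \<in> {- int n..int n}")
  case True
  then show ?thesis using assms by (simp add: hyperoctahedral_def)
next
  case False
  then have "- i \<notin> {- int n..int n}" by auto
  then show ?thesis
    using False permutes_not_in[OF hyperoctahedral_permutes[OF assms]] by metis
qed

lemma hyperoctahedral_zero: "w \<in> hyperoctahedral n \<Longrightarrow> w 0 = 0"
  using hyperoctahedral_minus[of w n 0] by simp

lemma hyperoctahedral_abs_le:
  assumes "w \<in> hyperoctahedral n"
  shows "\<bar>w i\<bar> \<le> int n \<longleftrightarrow> \<bar>i\<bar> \<le> int n"
  using permutes_in_image[OF hyperoctahedral_permutes[OF assms], of i] by auto

lemma hyperoctahedral_eq_iff: "w \<in> hyperoctahedral n \<Longrightarrow> w i = w j \<longleftrightarrow> i = j"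
  using permutes_inj[OF hyperoctahedral_permutes] by (auto dest: injD)

lemma hyperoctahedral_inv:
  assumes "w \<in> hyperoctahedral n"
  shows "inv w \<in> hyperoctahedral n"
proof -
  note p = hyperoctahedral_permutes[OF assms]
  have "inv w (- i) = - inv w i" for i
    using permutes_inverses[OF p] hyperoctahedral_minus[OF assms] by metis
  then show ?thesis
    using permutes_inv[OF p] by (auto simp: hyperoctahedral_def)
qed

lemma hyperoctahedral_comp:
  assumes "v \<in> hyperoctahedral n" "w \<in> hyperoctahedral n"
  shows "v \<circ> w \<in> hyperoctahedral n"
  using permutes_compose[OF hyperoctahedral_permutes hyperoctahedral_permutes, OF assms(2,1)]
  by (auto simp: hyperoctahedral_def[of n] hyperoctahedral_minus[OF assms(1)] hyperoctahedral_minus[OF assms(2)])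

text \<open>The arguments with a value below \<open>w i\<close> correspond under \<open>w\<close> to
  \<open>{-n..<w i}\<close>. Hence a signed permutation is determined by the relative order of its
  values.\<close>

lemma hyperoctahedral_eq_card:
  assumes w: "w \<in> hyperoctahedral n" and i: "\<bar>i\<bar> \<le> int n"
  shows "w i = int (card {j \<in> {- int n..int n}. w j < w i}) - int n"
proof -
  note p = hyperoctahedral_permutes[OF w]
  have "bij_betw w {j \<in> {- int n..int n}. w j < w i} {- int n..<w i}"
    unfolding bij_betw_def
  proof
    show "inj_on w {j \<in> {- int n..int n}. w j < w i}"
      using hyperoctahedral_eq_iff[OF w] by (auto simp: inj_on_def)
    show "w ` {j \<in> {- int n..int n}. w j < w i} = {- int n..<w i}"
    proof (intro equalityI subsetI)
      fix y assume y: "y \<in> {- int n..<w i}"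
      have "\<bar>y\<bar> \<le> int n" using y i hyperoctahedral_abs_le[OF w, of i] by auto
      then have "\<bar>inv w y\<bar> \<le> int n" 
        using hyperoctahedral_abs_le[OF hyperoctahedral_inv[OF w], of y] by simp
      moreover have "w (inv w y) = y" using permutes_inverses[OF p] by simp
      ultimately show "y \<in> w ` {j \<in> {- int n..int n}. w j < w i}"
        using y by (intro image_eqI[of _ _ "inv w y"]) auto
    next
      fix y assume "y \<in> w ` {j \<in> {- int n..int n}. w j < w i}"
      then obtain j where "j \<in> {- int n..int n}" "y = w j" "w j < w i" by blast
      then show "y \<in> {- int n..<w i}"
        using hyperoctahedral_abs_le[OF w, of j] by auto
    qed
  qed
  then have "card {j \<in> {- int n..int n}. w j < w i} = card {- int n..<w i}"
    by (rule bij_betw_same_card)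
  moreover have "- int n \<le> w i"
    using i hyperoctahedral_abs_le[OF w, of i] by auto
  ultimately show ?thesis by simp
qed

lemma hyperoctahedral_eqI:
  assumes "v \<in> hyperoctahedral n" "w \<in> hyperoctahedral n"
    and "\<And>i j. \<bar>i\<bar> \<le> int n \<Longrightarrow> \<bar>j\<bar> \<le> int n \<Longrightarrow> v i < v j \<longleftrightarrow> w i < w j"
  shows "v = w"
proof
  fix i show "v i = w i"
  proof (cases "\<bar>i\<bar> \<le> int n")
    case True
    have "{j \<in> {- int n..int n}. v j < v i} = {j \<in> {- int n..int n}. w j < w i}"
      using assms(3)[OF _ True] by auto
    then show ?thesis
      using hyperoctahedral_eq_card[OF assms(1) True] hyperoctahedral_eq_card[OF assms(2) True] by simp
  next
    case False
    then have "i \<notin> {- int n..int n}" by auto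
    then show ?thesis
      using permutes_not_in[OF hyperoctahedral_permutes] assms(1,2) by metis
  qed
qed

text \<open>Ranking the indices by their keys gives a permutation, and it is odd because negation
  reverses the order of the keys.\<close>

lemma hyperoctahedral_standardization:
  fixes k :: "int \<Rightarrow> int"
  assumes odd: "\<And>i. k (- i) = - k i" and inj: "inj_on k {- int n..int n}"
  shows "\<exists>w\<in>hyperoctahedral n. \<forall>i j. \<bar>i\<bar> \<le> int n \<longrightarrow> \<bar>j\<bar> \<le> int n \<longrightarrow> (w i < w j \<longleftrightarrow> k i < k j)"
proof -
  let ?I = "{- int n..int n}"
  define r where "r i = card {j \<in> ?I. k j < k i}" for i
  \<comment> \<open>Ranks run from 0 to \<open>2n\<close>; subtracting \<open>n\<close> centres them
    at 0.\<close>
  define w where "w i = (if i \<in> ?I then int (r i) - int n else i)" for i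
  have r_less: "r i < r j" if "k i < k j" "i \<in> ?I" for i j
    unfolding r_def using that by (intro psubset_card_mono finite_Collect_conjI) auto
  have r_iff: "r i < r j \<longleftrightarrow> k i < k j" if "i \<in> ?I" "j \<in> ?I" for i j
    using r_less[OF _ that(1), of j] r_less[OF _ that(2), of i]
    by (cases "k i" "k j" rule: linorder_cases) (auto simp: r_def)
  have r_minus: "r (- i) + r i = 2 * n" if i: "i \<in> ?I" for i
  proof -
    \<comment> \<open>Negation carries the keys below \<open>k (- i)\<close> to the keys above
      \<open>k i\<close>. Together with the keys below \<open>k i\<close> and \<open>i\<close>
      itself they account for all \<open>2n + 1\<close> indices.\<close>
    have "bij_betw uminus {j \<in> ?I. k j < k (- i)} {j \<in> ?I. k i < k j}"
      by (rule bij_betw_byWitness[where f' = uminus]) (auto simp: odd)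
    then have "r (- i) = card {j \<in> ?I. k i < k j}"
      unfolding r_def by (rule bij_betw_same_card)
    moreover have fin: "finite {j \<in> ?I. k i < k j}" "finite {j \<in> ?I. k j < k i}"
      by (rule finite_subset[of _ ?I]; auto)+
    moreover have "card ?I = card ({j \<in> ?I. k i < k j} \<union> {j \<in> ?I. k j < k i}) + card {i}"
    proof (subst card_Un_disjoint[symmetric])
      have "?I = {j \<in> ?I. k i < k j} \<union> {j \<in> ?I. k j < k i} \<union> {i}"
      proof (intro equalityI subsetI)
        fix j assume j: "j \<in> ?I"
        then show "j \<in> {j \<in> ?I. k i < k j} \<union> {j \<in> ?I. k j < k i} \<union> {i}"
          using inj_onD[OF inj _ i j] by (cases "k i" "k j" rule: linorder_cases) auto
      qed (use i in auto)
      then show "card ?I = card ({j \<in> ?I. k i < k j} \<union> {j \<in> ?I. k j < k i} \<union> {i})" by (rule arg_cong)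
    qed (use fin in auto)
    moreover have "card ({j \<in> ?I. k i < k j} \<union> {j \<in> ?I. k j < k i})
        = card {j \<in> ?I. k i < k j} + card {j \<in> ?I. k j < k i}"
      by (rule card_Un_disjoint) (use fin in auto)
    ultimately show ?thesis by (simp add: r_def)
  qed
  have "inj_on w ?I"
  proof (rule inj_onI)
    fix i j assume ij: "i \<in> ?I" "j \<in> ?I" and "w i = w j"
    then have "r i = r j" by (simp add: w_def)
    then have "k i = k j"
      using r_iff[OF ij] r_iff[OF ij(2,1)] by simp
    then show "i = j"
      by (rule inj_onD[OF inj _ ij])
  qed
  \<comment> \<open>Two ranks with sum \<open>2n\<close> both lie between 0 and
    \<open>2n\<close>.\<close>
  moreover have "w ` ?I \<subseteq> ?I"
  proof
    fix y assume "y \<in> w ` ?I"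
    then obtain i where "i \<in> ?I" "y = w i" by auto
    then show "y \<in> ?I" using r_minus[of i] by (auto simp: w_def)
  qed
  ultimately have "bij_betw w ?I ?I"
    by (simp add: bij_betw_def endo_inj_surj)
  then have "w permutes ?I"
    by (rule bij_imp_permutes) (simp only: w_def if_False)
  moreover have "w (- i) = - w i" if "i \<in> ?I" for i
    using r_minus[OF that] that by (auto simp: w_def)
  ultimately have "w \<in> hyperoctahedral n"
    by (simp add: hyperoctahedral_def)
  moreover have "w i < w j \<longleftrightarrow> k i < k j" if "\<bar>i\<bar> \<le> int n" "\<bar>j\<bar> \<le> int n" for i j
    using r_iff[of i j] that by (auto simp: w_def)
  ultimately show ?thesis by blast
qed


section \<open>Odd functions counted by descents\<close>

text \<open>\<open>S\<close> restricts only the positive positions: oddness forces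
  \<open>F 0 = 0\<close>, and 0 may be missing from \<open>S\<close>. The default value outside the
  range makes \<open>F\<close> determined by its values on \<open>{1..n}\<close>.\<close>

definition odd_seqs :: "nat \<Rightarrow> (int \<Rightarrow> int) \<Rightarrow> int set \<Rightarrow> (int \<Rightarrow> int) set" where
  "odd_seqs n w S = {F. (\<forall>i. F (- i) = - F i) \<and> (\<forall>i. int n < \<bar>i\<bar> \<longrightarrow> F i = 0) \<and>
     (\<forall>i\<in>{1..int n}. F i \<in> S) \<and>
     (\<forall>i\<in>{0..<int n}. F i < F (i + 1) \<or> F i = F (i + 1) \<and> w i < w (i + 1))}"

lemma odd_at_zero: "(\<And>i. F (- i) = - F i) \<Longrightarrow> F 0 = (0 :: int)" for F :: "int \<Rightarrow> int"
  by (metis add.inverse_neutral equal_neg_zero)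

lemma odd_seqs_nonneg:
  assumes "F \<in> odd_seqs n w S" "0 \<le> i" "i \<le> int n"
  shows "0 \<le> F i"
  using assms(2,3)
proof (induction i rule: int_ge_induct)
  case base
  show ?case using assms(1) odd_at_zero[of F] by (simp add: odd_seqs_def)
next
  case (step i)
  then have "F i < F (i + 1) \<or> F i = F (i + 1)"
    using assms(1) by (auto simp: odd_seqs_def)
  then show ?case using step by auto
qed

lemma card_odd_seqs:
  fixes q r :: int
  \<comment> \<open>For \<open>0 < r\<close> the step from \<open>F 0 = 0\<close> to \<open>F 1 \<ge> r\<close> is always strict.\<close>
  assumes S: "{x \<in> S. 0 \<le> x} = (\<lambda>c. q * c + r) ` {0..int m}" and q: "0 < q" and r: "0 \<le> r"
  shows "finite (odd_seqs n w S) \<and> card (odd_seqs n w S)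
    = (m + n - card {i \<in> {0..<int n}. \<not> (w i < w (i + 1) \<or> i = 0 \<and> 0 < r)} choose n)"
proof -
  define Q where "Q i = (w i < w (i + 1) \<or> i = 0 \<and> 0 < r)" for i
  \<comment> \<open>\<open>ext\<close> rescales a bounded sequence to the nonnegative elements of
    \<open>S\<close> and extends it to an odd function; \<open>res\<close> undoes this on the
    positive half.\<close>
  define ext where "ext c i = (if i \<in> {1..int n} then q * c i + r
    else if - i \<in> {1..int n} then - (q * c (- i) + r) else 0)" for c :: "int \<Rightarrow> int" and i
  define res where "res F i = (if i \<in> {1..int n} then (F i - r) div q else 0)" for F :: "int \<Rightarrow> int" and i
  have val: "\<exists>c. F i = q * c + r \<and> 0 \<le> c \<and> c \<le> int m"
    if "F \<in> odd_seqs n w S" "i \<in> {1..int n}" for F i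
  proof -
    have "F i \<in> {x \<in> S. 0 \<le> x}"
      using that odd_seqs_nonneg[OF that(1), of i] by (auto simp: odd_seqs_def)
    then show ?thesis unfolding S by auto
  qed
  have res: "F i = q * res F i + r" "0 \<le> res F i" "res F i \<le> int m"
    if "F \<in> odd_seqs n w S" "i \<in> {1..int n}" for F i
    using val[OF that] that(2) q by (auto simp: res_def)
  have lt: "q * x + r < q * y + r \<longleftrightarrow> x < y" "q * x + r = q * y + r \<longleftrightarrow> x = y" for x y
    using q by auto
  have "bij_betw ext (bounded_seqs n (int m) Q) (odd_seqs n w S)"
  proof (rule bij_betw_byWitness[where f' = res])
    show "\<forall>c\<in>bounded_seqs n (int m) Q. res (ext c) = c"
      using q by (auto simp: res_def ext_def bounded_seqs_def fun_eq_iff)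
    show "\<forall>F\<in>odd_seqs n w S. ext (res F) = F"
    proof (intro ballI ext)
      fix F i assume F: "F \<in> odd_seqs n w S"
      have o: "F (- i) = - F i" "\<And>i. int n < \<bar>i\<bar> \<Longrightarrow> F i = 0" "F 0 = 0" for i
        using F odd_at_zero[of F] by (auto simp: odd_seqs_def)
      consider "i \<in> {1..int n}" | "- i \<in> {1..int n}" | "i = 0" | "int n < \<bar>i\<bar>" by force
      then show "ext (res F) i = F i"
      proof cases
        case 1
        then show ?thesis using res(1)[OF F 1] by (simp add: ext_def)
      next
        case 2
        then show ?thesis using res(1)[OF F 2] o(1)[of i] by (auto simp: ext_def)
      qed (auto simp: ext_def o)
    qed
    show "ext ` bounded_seqs n (int m) Q \<subseteq> odd_seqs n w S"
    proof
      fix F assume "F \<in> ext ` bounded_seqs n (int m) Q"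
      then obtain c where c: "c \<in> bounded_seqs n (int m) Q" and F: "F = ext c" by auto
      have "F i \<in> S" if i: "i \<in> {1..int n}" for i
      proof -
        have "c i \<in> {0..int m}" using bounded_seqs_bounds[OF c, of i] i by auto
        then have "q * c i + r \<in> {x \<in> S. 0 \<le> x}" unfolding S by blast
        then show ?thesis using i by (simp add: F ext_def)
      qed
      moreover have "F i < F (i + 1) \<or> F i = F (i + 1) \<and> w i < w (i + 1)" if i: "i \<in> {0..<int n}" for i
      proof (cases "i = 0")
        case True
        have "c 0 = 0"
          using c by (simp add: bounded_seqs_def)
        moreover have "c 0 < c 1 \<or> c 0 = c 1 \<and> Q 0"
        proof -
          have "\<forall>i\<in>{0..<int n}. c i < c (i + 1) \<or> c i = c (i + 1) \<and> Q i"
            using c by (simp add: bounded_seqs_def)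
          from bspec[OF this i] show ?thesis by (simp add: True)
        qed
        moreover have "0 < q * c 1" if "0 < c 1" using q that by simp
        ultimately show ?thesis
          using i r q by (auto simp: F ext_def True Q_def add_pos_nonneg)
      next
        case False
        have "c i < c (i + 1) \<or> c i = c (i + 1) \<and> Q i"
          using c i by (auto simp: bounded_seqs_def)
        then show ?thesis
          using i False lt by (auto simp: F ext_def Q_def)
      qed
      ultimately show "F \<in> odd_seqs n w S"
        by (auto simp: odd_seqs_def) (auto simp: F ext_def)
    qed
    show "res ` odd_seqs n w S \<subseteq> bounded_seqs n (int m) Q"
    proof
      fix c assume "c \<in> res ` odd_seqs n w S"
      then obtain F where F: "F \<in> odd_seqs n w S" and c: "c = res F" by auto
      have F0: "F 0 = 0" using F odd_at_zero[of F] by (simp add: odd_seqs_def)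
      have "c (int n) \<le> int m"
        using res(3)[OF F, of "int n"] by (cases "n = 0") (auto simp: c res_def)
      moreover have "c i < c (i + 1) \<or> c i = c (i + 1) \<and> Q i" if i: "i \<in> {0..<int n}" for i
      proof -
        have st: "F i < F (i + 1) \<or> F i = F (i + 1) \<and> w i < w (i + 1)"
          using F i by (auto simp: odd_seqs_def)
        have i1: "i + 1 \<in> {1..int n}" using i by auto
        show ?thesis
        proof (cases "i = 0")
          case True
          then have "c i = 0" by (simp add: c res_def)
          moreover have "0 \<le> c (i + 1)" using res(2)[OF F i1] by (simp add: c)
          \<comment> \<open>Here \<open>F 1 = r\<close>: either this is positive, or it equals
            \<open>F 0\<close> and then \<open>w\<close> ascends at 0.\<close>
          moreover have "Q i" if "c (i + 1) = 0"
            using st res(1)[OF F i1] that True F0 by (auto simp: Q_def c)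
          ultimately show ?thesis by auto
        next
          case False
          then have "i \<in> {1..int n}" using i by auto
          then show ?thesis
            using st res(1)[OF F i1] res(1)[OF F, of i] lt by (auto simp: Q_def c)
        qed
      qed
      ultimately show "c \<in> bounded_seqs n (int m) Q"
        by (auto simp: bounded_seqs_def) (auto simp: c res_def)
    qed
  qed
  then show ?thesis
    using card_bounded_seqs[of n "int m" Q] bij_betw_finite bij_betw_same_card
    by (fastforce simp: Q_def)
qed

text \<open>By injectivity, a step of \<open>w\<close> that does not ascend descends.\<close>

lemma card_descents:
  assumes "w \<in> hyperoctahedral n"
  shows "card {i \<in> {0..<int n}. \<not> w i < w (i + 1)} = des_B n w"
    and "card {i \<in> {0..<int n}. \<not> (w i < w (i + 1) \<or> i = 0)} = des_A n w"
proof -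
  have eq: "\<not> w i < w (i + 1) \<longleftrightarrow> w i > w (i + 1)" for i
    using hyperoctahedral_eq_iff[OF assms, of i "i + 1"] by auto
  show "card {i \<in> {0..<int n}. \<not> w i < w (i + 1)} = des_B n w"
    unfolding des_B_def eq by (rule arg_cong[of _ _ card]) auto
  show "card {i \<in> {0..<int n}. \<not> (w i < w (i + 1) \<or> i = 0)} = des_A n w"
    unfolding des_A_def de_Morgan_disj eq by (rule arg_cong[of _ _ card]) auto
qed

text \<open>The case \<open>q = 1\<close>, \<open>r = 0\<close>: the step at 0 is treated like all
  others, whence \<open>des_B\<close>.\<close>

lemma card_odd_seqs_interval:
  assumes "w \<in> hyperoctahedral n"
  shows "finite (odd_seqs n w {- int m..int m})"
    and "card (odd_seqs n w {- int m..int m}) = (m + n - des_B n w choose n)"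
proof -
  have "{x \<in> {- int m..int m}. 0 \<le> x} = (\<lambda>c. 1 * c + 0) ` {0..int m}"
    by auto
  from card_odd_seqs[OF this, of n w] card_descents(1)[OF assms]
  show "finite (odd_seqs n w {- int m..int m})"
    and "card (odd_seqs n w {- int m..int m}) = (m + n - des_B n w choose n)"
    by simp_all
qed

definition odd_interval :: "nat \<Rightarrow> int set" where
  "odd_interval m = {x. odd x \<and> \<bar>x\<bar> \<le> 2 * int m + 1}"

text \<open>The case \<open>q = 2\<close>, \<open>r = 1\<close>: a descent at 0 imposes nothing,
  whence \<open>des_A\<close>.\<close>

lemma card_odd_seqs_odd_interval:
  assumes "w \<in> hyperoctahedral n"
  shows "finite (odd_seqs n w (odd_interval m))"
    and "card (odd_seqs n w (odd_interval m)) = (m + n - des_A n w choose n)"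
proof -
  have "{x \<in> odd_interval m. 0 \<le> x} = (\<lambda>c. 2 * c + 1) ` {0..int m}"
  proof (intro equalityI subsetI)
    fix x assume "x \<in> {x \<in> odd_interval m. 0 \<le> x}"
    then show "x \<in> (\<lambda>c. 2 * c + 1) ` {0..int m}"
      by (intro image_eqI[of _ _ "x div 2"]) (auto simp: odd_interval_def)
  qed (auto simp: odd_interval_def)
  from card_odd_seqs[OF this, of n w] card_descents(2)[OF assms]
  show "finite (odd_seqs n w (odd_interval m))"
    and "card (odd_seqs n w (odd_interval m)) = (m + n - des_A n w choose n)"
    by simp_all
qed

section \<open>Lexicographic comparison of pairs\<close>

text \<open>\<open>u\<close> and \<open>v\<close> differ by at most \<open>2n\<close>, which cannot
  offset a gap of \<open>2n + 1\<close> or more.\<close>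

lemma lex_less_iff:
  fixes M :: int
  assumes "\<bar>u\<bar> \<le> int n" "\<bar>v\<bar> \<le> int n"
  shows "(2 * int n + 1) * x + u < (2 * int n + 1) * y + v \<longleftrightarrow> x < y \<or> x = y \<and> u < v"
proof -
  have *: "(2 * int n + 1) * x + u < (2 * int n + 1) * y + v"
    if "x < y" "\<bar>u\<bar> \<le> int n" "\<bar>v\<bar> \<le> int n" for x y u v :: int
  proof -
    have "(2 * int n + 1) * (x + 1) \<le> (2 * int n + 1) * y"
      using that by (intro mult_left_mono) auto
    then show ?thesis using that by (simp add: algebra_simps)
  qed
  show ?thesis
    using *[of x y u v] *[of y x v u] assms by (cases x y rule: linorder_cases) auto
qed

text \<open>For \<open>i < 0\<close>, oddness mirrors the step from \<open>i\<close> to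
  \<open>i + 1\<close> into the step from \<open>- (i + 1)\<close> to \<open>- i\<close>.\<close>

lemma odd_increasing:
  fixes k :: "int \<Rightarrow> int"
  assumes odd: "\<And>i. k (- i) = - k i"
    and step: "\<And>i. 0 \<le> i \<Longrightarrow> i < int n \<Longrightarrow> k i < k (i + 1)"
    and ij: "- int n \<le> i" "i < j" "j \<le> int n"
  shows "k i < k j"
proof -
  have all: "k i < k (i + 1)" if "- int n \<le> i" "i < int n" for i
  proof (cases "0 \<le> i")
    case True
    then show ?thesis using step that by blast
  next
    case False
    then have "k (- (i + 1)) < k (- (i + 1) + 1)" using that by (intro step) auto
    then show ?thesis using odd[of i] odd[of "i + 1"] by simp
  qed
  have "i + 1 \<le> j" using ij by simp
  then show ?thesis using ij(3)
  proof (induction j rule: int_ge_induct)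
    case base
    then show ?case using all[of i] ij by simp
  next
    case (step j)
    then show ?case using all[of j] ij by fastforce
  qed
qed

text \<open>As \<open>\<bar>w i\<bar> \<le> n\<close>, this integer orders the pairs \<open>(F i, w i)\<close> lexicographically, and it is odd in \<open>i\<close>.\<close>

definition lex_key :: "nat \<Rightarrow> (int \<Rightarrow> int) \<Rightarrow> (int \<Rightarrow> int) \<Rightarrow> int \<Rightarrow> int" where
  "lex_key n w F i = (2 * int n + 1) * F i + w i"

lemma lex_key_less_iff:
  assumes "w \<in> hyperoctahedral n" "\<bar>i\<bar> \<le> int n" "\<bar>j\<bar> \<le> int n"
  shows "lex_key n w F i < lex_key n w F j \<longleftrightarrow> F i < F j \<or> F i = F j \<and> w i < w j"
  unfolding lex_key_def
  using lex_less_iff hyperoctahedral_abs_le[OF assms(1)] assms(2,3) by blast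

lemma lex_key_increasing:
  assumes w: "w \<in> hyperoctahedral n" and F: "F \<in> odd_seqs n w S"
    and "- int n \<le> i" "i < j" "j \<le> int n"
  shows "lex_key n w F i < lex_key n w F j"
proof (rule odd_increasing[where k = "lex_key n w F" and n = n])
  show "lex_key n w F (- i) = - lex_key n w F i" for i
    using F hyperoctahedral_minus[OF w] by (simp add: lex_key_def odd_seqs_def)
  show "lex_key n w F i < lex_key n w F (i + 1)" if "0 \<le> i" "i < int n" for i
    using F that by (subst lex_key_less_iff[OF w]) (auto simp: odd_seqs_def)
qed fact+

lemma lex_key_less_iff_index:
  assumes w: "w \<in> hyperoctahedral n" and F: "F \<in> odd_seqs n w S"
    and "\<bar>i\<bar> \<le> int n" "\<bar>j\<bar> \<le> int n"
  shows "lex_key n w F i < lex_key n w F j \<longleftrightarrow> i < j"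
proof (cases i j rule: linorder_cases)
  case less
  then show ?thesis using lex_key_increasing[OF w F, of i j] assms(3,4) by auto
next
  case greater
  then have "lex_key n w F j < lex_key n w F i"
    using assms(3,4) by (intro lex_key_increasing[OF w F]) auto
  then show ?thesis using greater by simp
qed simp

section \<open>Factorizations as lexicographically increasing triples\<close>

text \<open>\<open>f\<close> stands for \<open>a \<circ> \<tau>\<close>, which need not increase by
  itself: together with \<open>w\<close> it only breaks ties of \<open>b\<close>.\<close>

definition lex_pairs :: "nat \<Rightarrow> (int \<Rightarrow> int) \<Rightarrow> int set \<Rightarrow> int set \<Rightarrow> ((int \<Rightarrow> int) \<times> (int \<Rightarrow> int)) set" where
  "lex_pairs n w T S = {(b, f).
     (\<forall>i. b (- i) = - b i) \<and> (\<forall>i. f (- i) = - f i) \<and>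
     (\<forall>i. int n < \<bar>i\<bar> \<longrightarrow> b i = 0) \<and> (\<forall>i. int n < \<bar>i\<bar> \<longrightarrow> f i = 0) \<and>
     (\<forall>i\<in>{1..int n}. b i \<in> T) \<and> (\<forall>i\<in>{1..int n}. f i \<in> S) \<and>
     (\<forall>i\<in>{0..<int n}. b i < b (i + 1) \<or> b i = b (i + 1) \<and>
        (f i < f (i + 1) \<or> f i = f (i + 1) \<and> w i < w (i + 1)))}"

text \<open>Signed permutations may send positive indices to negative ones; oddness and the symmetry
  of \<open>S\<close> cover these.\<close>

lemma odd_values_mem:
  fixes F :: "int \<Rightarrow> int"
  assumes "\<And>i. F (- i) = - F i" "\<forall>i\<in>{1..int n}. F i \<in> S" "\<And>x. x \<in> S \<Longrightarrow> - x \<in> S"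
    and "\<bar>i\<bar> \<le> int n" "i \<noteq> 0"
  shows "F i \<in> S"
proof (cases "0 < i")
  case True
  then show ?thesis using assms by auto
next
  case False
  then have "F (- i) \<in> S" using assms(2,4,5) by auto
  from assms(3)[OF this] show ?thesis by (simp add: assms(1))
qed

text \<open>The order of the pairs \<open>(f i, w i)\<close> with
  \<open>f = a \<circ> \<tau>\<close> is the order of the values \<open>\<tau> i\<close>. So
  \<open>\<tau>\<close> is the standardization of these pairs, and then \<open>\<sigma>\<close> and
  \<open>a\<close> arise from \<open>w\<close> and \<open>f\<close> by composition with
  \<open>inv \<tau>\<close>.\<close>

lemma bij_betw_factorizations_lex_pairs:
  assumes w: "w \<in> hyperoctahedral n" and S: "\<And>x. x \<in> S \<Longrightarrow> - x \<in> S"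
  shows "bij_betw (\<lambda>((\<sigma>, \<tau>), (a, b)). (b, a \<circ> \<tau>))
    (SIGMA (\<sigma>, \<tau>):factorizations n w. odd_seqs n \<sigma> S \<times> odd_seqs n \<tau> T) (lex_pairs n w T S)"
    (is "bij_betw ?h ?X ?Y")
proof -
  have key: "lex_key n w (a \<circ> \<tau>) i = lex_key n \<sigma> a (\<tau> i)"
    if "(\<sigma>, \<tau>) \<in> factorizations n w" for \<sigma> \<tau> a i
    using that by (auto simp: factorizations_def lex_key_def)
  have key_less: "lex_key n w (a \<circ> \<tau>) i < lex_key n w (a \<circ> \<tau>) j \<longleftrightarrow> \<tau> i < \<tau> j"
    if "(\<sigma>, \<tau>) \<in> factorizations n w" "a \<in> odd_seqs n \<sigma> S" "\<bar>i\<bar> \<le> int n" "\<bar>j\<bar> \<le> int n" for \<sigma> \<tau> a i j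
    unfolding key[OF that(1)] using that hyperoctahedral_abs_le[of \<tau> n]
    by (intro lex_key_less_iff_index) (auto simp: factorizations_def)
  have "inj_on ?h ?X"
  proof (rule inj_onI)
    fix x y assume "x \<in> ?X" "y \<in> ?X" and eq: "?h x = ?h y"
    then obtain \<sigma> \<tau> a b \<sigma>' \<tau>' a' b' where x: "x = ((\<sigma>, \<tau>), (a, b))" and y: "y = ((\<sigma>', \<tau>'), (a', b'))"
      and f: "(\<sigma>, \<tau>) \<in> factorizations n w" "(\<sigma>', \<tau>') \<in> factorizations n w"
      and ab: "a \<in> odd_seqs n \<sigma> S" "a' \<in> odd_seqs n \<sigma>' S" by auto
    have eq: "b = b'" "a \<circ> \<tau> = a' \<circ> \<tau>'" using eq by (auto simp: x y)
    \<comment> \<open>Both permutations order the indices by the same keys, since these depend only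
      on \<open>w\<close> and the common function \<open>a \<circ> \<tau>\<close>.\<close>
    have "\<tau> = \<tau>'"
      using f key_less[OF f(1) ab(1)] key_less[OF f(2) ab(2)] unfolding eq
      by (intro hyperoctahedral_eqI[of _ n]) (auto simp: factorizations_def)
    moreover have surj: "surj \<tau>"
      using f permutes_surj[OF hyperoctahedral_permutes] by (auto simp: factorizations_def)
    moreover have "\<sigma> \<circ> \<tau> = \<sigma>' \<circ> \<tau>'"
      using f by (simp add: factorizations_def)
    moreover have "g = g'" if "g \<circ> \<tau> = g' \<circ> \<tau>" for g g' :: "int \<Rightarrow> int"
      using that surj by (metis fun_eq_iff comp_apply surj_def)
    ultimately show "x = y"
      using eq by (simp add: x y)
  qed
  moreover have "?h x \<in> ?Y" if "x \<in> ?X" for x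
  proof -
    from that obtain \<sigma> \<tau> a b where x: "x = ((\<sigma>, \<tau>), (a, b))"
      and f: "(\<sigma>, \<tau>) \<in> factorizations n w"
      and a: "a \<in> odd_seqs n \<sigma> S" and b: "b \<in> odd_seqs n \<tau> T" by auto
    have \<tau>: "\<tau> \<in> hyperoctahedral n" using f by (auto simp: factorizations_def)
    have ao: "a (- i) = - a i" for i using a by (simp add: odd_seqs_def)
    have "a (\<tau> i) \<in> S" if "i \<in> {1..int n}" for i
    proof (rule odd_values_mem[of a, OF ao _ S])
      show "\<tau> i \<noteq> 0"
        using that hyperoctahedral_eq_iff[OF \<tau>, of i 0] hyperoctahedral_zero[OF \<tau>] by auto
    qed (use a that hyperoctahedral_abs_le[OF \<tau>, of i] in \<open>auto simp: odd_seqs_def\<close>)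
    moreover have "a (\<tau> i) = 0" if "int n < \<bar>i\<bar>" for i
      using a that hyperoctahedral_abs_le[OF \<tau>, of i] by (auto simp: odd_seqs_def)
    moreover have "b i < b (i + 1) \<or> b i = b (i + 1) \<and>
        (a (\<tau> i) < a (\<tau> (i + 1)) \<or> a (\<tau> i) = a (\<tau> (i + 1)) \<and> w i < w (i + 1))"
      if i: "i \<in> {0..<int n}" for i
    proof -
      have "b i < b (i + 1) \<or> b i = b (i + 1) \<and> \<tau> i < \<tau> (i + 1)"
        using b i by (auto simp: odd_seqs_def)
      \<comment> \<open>A tie of \<open>b\<close> is broken by \<open>\<tau>\<close>, hence equally
        by the pairs \<open>(a (\<tau> i), w i)\<close>.\<close>
      then show ?thesis
        using key_less[OF f a, of i "i + 1"] lex_key_less_iff[OF w, of i "i + 1" "a \<circ> \<tau>"] i by auto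
    qed
    ultimately show ?thesis
      using b by (auto simp: x lex_pairs_def odd_seqs_def[of n \<tau>] ao hyperoctahedral_minus[OF \<tau>])
  qed
  moreover have "\<exists>x\<in>?X. y = ?h x" if y: "y \<in> ?Y" for y
  proof -
    obtain b f where y': "y = (b, f)" by (cases y)
    have bf: "f (- i) = - f i" "b (- i) = - b i" for i
      using y by (auto simp: y' lex_pairs_def)
    have mono: "b i < b (i + 1) \<or> b i = b (i + 1) \<and>
        (f i < f (i + 1) \<or> f i = f (i + 1) \<and> w i < w (i + 1))" if "i \<in> {0..<int n}" for i
      using y that by (auto simp: y' lex_pairs_def)
    \<comment> \<open>Equal keys mean equal pairs, and the second entries come from the injective
      \<open>w\<close>.\<close>
    have "inj_on (lex_key n w f) {- int n..int n}"
    proof (rule inj_onI)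
      fix i j assume ij: "i \<in> {- int n..int n}" "j \<in> {- int n..int n}"
        and eq: "lex_key n w f i = lex_key n w f j"
      then have "\<bar>i\<bar> \<le> int n" "\<bar>j\<bar> \<le> int n" by auto
      then have "f i = f j \<and> w i = w j"
        using eq lex_key_less_iff[OF w, of i j f] lex_key_less_iff[OF w, of j i f]
        by (metis less_irrefl linorder_less_linear)
      then show "i = j" using hyperoctahedral_eq_iff[OF w] by simp
    qed
    moreover have "lex_key n w f (- i) = - lex_key n w f i" for i
      using bf hyperoctahedral_minus[OF w] by (simp add: lex_key_def)
    ultimately obtain \<tau> where \<tau>: "\<tau> \<in> hyperoctahedral n"
      and less: "\<And>i j. \<bar>i\<bar> \<le> int n \<Longrightarrow> \<bar>j\<bar> \<le> int n \<Longrightarrow> \<tau> i < \<tau> j \<longleftrightarrow> lex_key n w f i < lex_key n w f j"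
      using hyperoctahedral_standardization[of "lex_key n w f" n] by blast
    define \<sigma> where "\<sigma> = w \<circ> inv \<tau>"
    define a where "a = f \<circ> inv \<tau>"
    note inv = hyperoctahedral_inv[OF \<tau>]
    have cancel: "\<tau> (inv \<tau> i) = i" "inv \<tau> (\<tau> i) = i" for i
      using permutes_inverses[OF hyperoctahedral_permutes[OF \<tau>]] by auto
    have a\<tau>: "a \<circ> \<tau> = f" and \<sigma>\<tau>: "\<sigma> \<circ> \<tau> = w"
      by (auto simp: a_def \<sigma>_def cancel)
    have \<sigma>: "\<sigma> \<in> hyperoctahedral n"
      unfolding \<sigma>_def by (rule hyperoctahedral_comp[OF w inv])
    have "a \<in> odd_seqs n \<sigma> S"
    proof -
      have "a i \<in> S" if "i \<in> {1..int n}" for i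
        unfolding a_def comp_def
      proof (rule odd_values_mem[of f, OF bf(1) _ S])
        show "inv \<tau> i \<noteq> 0"
          using that hyperoctahedral_eq_iff[OF inv, of i 0] hyperoctahedral_zero[OF inv] by auto
      qed (use y that hyperoctahedral_abs_le[OF inv, of i] in \<open>auto simp: y' lex_pairs_def\<close>)
      moreover have "a i = 0" if "int n < \<bar>i\<bar>" for i
        using y that hyperoctahedral_abs_le[OF inv, of i] by (auto simp: y' a_def lex_pairs_def)
      moreover have "a i < a (i + 1) \<or> a i = a (i + 1) \<and> \<sigma> i < \<sigma> (i + 1)" if "i \<in> {0..<int n}" for i
      proof -
        \<comment> \<open>The order property of \<open>\<tau>\<close> is applied at the preimages of
          the consecutive values \<open>i\<close> and \<open>i + 1\<close>.\<close>
        have ii: "\<bar>inv \<tau> i\<bar> \<le> int n" "\<bar>inv \<tau> (i + 1)\<bar> \<le> int n"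
          using hyperoctahedral_abs_le[OF inv] that by auto
        show ?thesis
          using less[OF ii] unfolding lex_key_less_iff[OF w ii]
          by (simp add: cancel a_def \<sigma>_def)
      qed
      ultimately show ?thesis
        by (auto simp: odd_seqs_def) (auto simp: a_def hyperoctahedral_minus[OF inv] bf)
    qed
    moreover have "b \<in> odd_seqs n \<tau> T"
    proof -
      have "b i < b (i + 1) \<or> b i = b (i + 1) \<and> \<tau> i < \<tau> (i + 1)" if "i \<in> {0..<int n}" for i
        using mono[OF that] less[of i "i + 1"] lex_key_less_iff[OF w, of i "i + 1" f] that by auto
      then show ?thesis
        using y by (auto simp: y' odd_seqs_def lex_pairs_def)
    qed
    moreover have "(\<sigma>, \<tau>) \<in> factorizations n w"
      using \<sigma> \<tau> \<sigma>\<tau> by (simp add: factorizations_def)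
    ultimately have "((\<sigma>, \<tau>), (a, b)) \<in> ?X" by blast
    moreover have "y = ?h ((\<sigma>, \<tau>), (a, b))" by (simp add: y' a\<tau>)
    ultimately show ?thesis by blast
  qed
  ultimately show ?thesis
    unfolding bij_betw_def by blast
qed

section \<open>Encoding pairs of values as single values\<close>

text \<open>A linear encoding preserves oddness, and \<open>lex\<close> with \<open>0 < q\<close>
  makes it respect the lexicographic order. The pair \<open>(0, 0)\<close> is inserted because it is
  the value at position 0 and need not lie in \<open>T \<times> S\<close>.\<close>

lemma bij_betw_lex_pairs_odd_seqs:
  fixes p q :: int
  assumes bij: "bij_betw (\<lambda>(x, y). p * x + q * y) (T \<times> S) U" and q: "0 < q"
    and lex: "\<And>x y x' y'. (x, y) \<in> insert (0, 0) (T \<times> S) \<Longrightarrow> (x', y') \<in> insert (0, 0) (T \<times> S)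
      \<Longrightarrow> x < x' \<Longrightarrow> p * x + q * y < p * x' + q * y'"
  shows "bij_betw (\<lambda>(b, f) i. p * b i + q * f i) (lex_pairs n w T S) (odd_seqs n w U)"
    (is "bij_betw ?h ?Y ?Z")
proof -
  have lex_iff: "p * x + q * y < p * x' + q * y' \<longleftrightarrow> x < x' \<or> x = x' \<and> y < y'"
    and lex_eq: "p * x + q * y = p * x' + q * y' \<longleftrightarrow> x = x' \<and> y = y'"
    if "(x, y) \<in> insert (0, 0) (T \<times> S)" "(x', y') \<in> insert (0, 0) (T \<times> S)" for x y x' y'
    using lex[OF that] lex[OF that(2,1)] q by (cases x x' rule: linorder_cases; force)+
  have mem: "(b i, f i) \<in> insert (0, 0) (T \<times> S)"
    if "b 0 = 0" "f 0 = 0" "\<forall>i\<in>{1..int n}. b i \<in> T" "\<forall>i\<in>{1..int n}. f i \<in> S" "0 \<le> i" "i \<le> int n" for b f i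
    using that by (cases "i = 0") auto
  have step: "(p * b i + q * f i < p * b (i + 1) + q * f (i + 1) \<or>
      p * b i + q * f i = p * b (i + 1) + q * f (i + 1) \<and> w i < w (i + 1)) \<longleftrightarrow>
      (b i < b (i + 1) \<or> b i = b (i + 1) \<and> (f i < f (i + 1) \<or> f i = f (i + 1) \<and> w i < w (i + 1)))"
    if "b 0 = 0" "f 0 = 0" "\<forall>i\<in>{1..int n}. b i \<in> T" "\<forall>i\<in>{1..int n}. f i \<in> S" "i \<in> {0..<int n}" for b f i
    using lex_iff[OF mem[OF that(1-4), of i] mem[OF that(1-4), of "i + 1"]]
      lex_eq[OF mem[OF that(1-4), of i] mem[OF that(1-4), of "i + 1"]] that(5) by auto
  have "inj_on ?h ?Y"
  proof (rule inj_onI, clarify)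
    fix b f b' f' assume Y: "(b, f) \<in> ?Y" "(b', f') \<in> ?Y"
      and eq: "(\<lambda>i. p * b i + q * f i) = (\<lambda>i. p * b' i + q * f' i)"
    have pos: "b i = b' i \<and> f i = f' i" if "0 < i" for i
    proof (cases "i \<le> int n")
      case True
      then show ?thesis
        using Y that fun_cong[OF eq, of i] lex_eq[of "b i" "f i" "b' i" "f' i"]
        by (auto simp: lex_pairs_def)
    next
      case False
      then show ?thesis using Y that by (auto simp: lex_pairs_def)
    qed
    have odd: "b (- i) = - b i" "b' (- i) = - b' i" "f (- i) = - f i" "f' (- i) = - f' i" for i
      using Y by (auto simp: lex_pairs_def)
    have "b i = b' i \<and> f i = f' i" for i
      using pos[of i] pos[of "- i"] odd[of i]
        odd_at_zero[of b] odd_at_zero[of b'] odd_at_zero[of f] odd_at_zero[of f'] odd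
      by (cases i "0 :: int" rule: linorder_cases) auto
    then show "b = b' \<and> f = f'" by blast
  qed
  moreover have "?h y \<in> ?Z" if y: "y \<in> ?Y" for y
  proof -
    obtain b f where y': "y = (b, f)" by (cases y)
    have z: "b 0 = 0" "f 0 = 0"
      using y odd_at_zero[of b] odd_at_zero[of f] by (auto simp: y' lex_pairs_def)
    have TS: "\<forall>i\<in>{1..int n}. b i \<in> T" "\<forall>i\<in>{1..int n}. f i \<in> S"
      using y by (auto simp: y' lex_pairs_def)
    have "p * b i + q * f i \<in> U" if "i \<in> {1..int n}" for i
      using bij_betwE[OF bij] TS that by fastforce
    then show ?thesis
      using y step[OF z TS] by (auto simp: y' lex_pairs_def odd_seqs_def right_diff_distrib)
  qed
  moreover have "\<exists>y\<in>?Y. F = ?h y" if F: "F \<in> ?Z" for F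
  proof -
    have "\<exists>z\<in>T \<times> S. F i = p * fst z + q * snd z" if "i \<in> {1..int n}" for i
      using F that bij_betw_imp_surj_on[OF bij] by (force simp: odd_seqs_def)
    then obtain z where z: "\<And>i. i \<in> {1..int n} \<Longrightarrow> z i \<in> T \<times> S \<and> F i = p * fst (z i) + q * snd (z i)"
      by metis
    \<comment> \<open>Decoding is possible at positive positions only; \<open>sgn\<close> extends
      the result to an odd function vanishing at 0.\<close>
    define b where "b i = (if \<bar>i\<bar> \<le> int n then sgn i * fst (z \<bar>i\<bar>) else 0)" for i
    define f where "f i = (if \<bar>i\<bar> \<le> int n then sgn i * snd (z \<bar>i\<bar>) else 0)" for i
    have odd: "b (- i) = - b i" "f (- i) = - f i" "F (- i) = - F i" for i
      using F by (auto simp: b_def f_def odd_seqs_def)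
    have z0: "b 0 = 0" "f 0 = 0" "F 0 = 0"
      using odd_at_zero[of F] odd by (auto simp: b_def f_def)
    have TS: "\<forall>i\<in>{1..int n}. b i \<in> T" "\<forall>i\<in>{1..int n}. f i \<in> S"
      using z by (auto simp: b_def f_def mem_Times_iff)
    have pos: "F i = p * b i + q * f i" if "0 < i" for i
      using that z[of i] F by (cases "i \<le> int n") (auto simp: b_def f_def odd_seqs_def)
    have eq: "F i = p * b i + q * f i" for i
      using pos[of i] pos[of "- i"] odd[of i] z0
      by (cases i "0 :: int" rule: linorder_cases) auto
    have "(b, f) \<in> ?Y"
      using F odd TS step[OF z0(1,2) TS] unfolding odd_seqs_def lex_pairs_def
      by (simp add: eq) (simp add: b_def f_def)
    moreover have "F = ?h (b, f)" using eq by auto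
    ultimately show ?thesis by blast
  qed
  ultimately show ?thesis
    unfolding bij_betw_def by blast
qed

text \<open>Both bijections are combined; finiteness turns the cardinality of the disjoint union
  into a sum.\<close>

lemma card_odd_seqs_factorizations:
  fixes p q :: int
  assumes w: "w \<in> hyperoctahedral n" and S: "\<And>x. x \<in> S \<Longrightarrow> - x \<in> S"
    and fin: "\<And>v. v \<in> hyperoctahedral n \<Longrightarrow> finite (odd_seqs n v S)"
      "\<And>v. v \<in> hyperoctahedral n \<Longrightarrow> finite (odd_seqs n v T)"
    and bij: "bij_betw (\<lambda>(x, y). p * x + q * y) (T \<times> S) U" and q: "0 < q"
    and lex: "\<And>x y x' y'. (x, y) \<in> insert (0, 0) (T \<times> S) \<Longrightarrow> (x', y') \<in> insert (0, 0) (T \<times> S)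
      \<Longrightarrow> x < x' \<Longrightarrow> p * x + q * y < p * x' + q * y'"
  shows "card (odd_seqs n w U)
    = (\<Sum>(\<sigma>, \<tau>)\<in>factorizations n w. card (odd_seqs n \<sigma> S) * card (odd_seqs n \<tau> T))"
proof -
  have "card (odd_seqs n w U) = card (lex_pairs n w T S)"
    using bij_betw_same_card[OF bij_betw_lex_pairs_odd_seqs[OF bij q lex]] by simp
  also have "\<dots> = card (SIGMA (\<sigma>, \<tau>):factorizations n w. odd_seqs n \<sigma> S \<times> odd_seqs n \<tau> T)"
    using bij_betw_same_card[OF bij_betw_factorizations_lex_pairs[OF w S]] by simp
  also have "\<dots> = (\<Sum>(\<sigma>, \<tau>)\<in>factorizations n w. card (odd_seqs n \<sigma> S) * card (odd_seqs n \<tau> T))"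
  proof (subst card_SigmaI)
    show "\<forall>x\<in>factorizations n w. finite (case x of (\<sigma>, \<tau>) \<Rightarrow> odd_seqs n \<sigma> S \<times> odd_seqs n \<tau> T)"
      using fin by (auto simp: factorizations_def)
  qed (auto simp: finite_factorizations card_cartesian_product intro!: sum.cong)
  finally show ?thesis .
qed


section \<open>Two tilings of the odd numbers in a symmetric interval\<close>

text \<open>\<open>odd_interval j\<close> consists of \<open>2j + 2\<close> consecutive odd numbers,
  so its translates by multiples of \<open>4j + 4\<close> tile the odd numbers. The
  \<open>2k + 1\<close> translates used reach up to \<open>(4j + 4)k + 2j + 1\<close>.\<close>

lemma bij_betw_interval_odd_interval:
  "bij_betw (\<lambda>(x, y). (4 * int j + 4) * x + 1 * y) ({- int k..int k} \<times> odd_interval j)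
     (odd_interval (2 * j * k + j + 2 * k))"
proof -
  define M where "M = 2 * int j + 2"
  have M: "0 < M" by (simp add: M_def)
  have N: "2 * int (2 * j * k + j + 2 * k) + 1 = 2 * M * int k + M - 1"
    by (simp add: M_def algebra_simps)
  have J: "2 * int j + 1 = M - 1" by (simp add: M_def)
  have "even M" by (simp add: M_def)
  \<comment> \<open>Adding \<open>M\<close> turns \<open>y\<close>, which lies strictly between
    \<open>- M\<close> and \<open>M\<close>, into a remainder modulo \<open>2M\<close>.\<close>
  let ?dec = "\<lambda>h. ((h + M) div (2 * M), (h + M) mod (2 * M) - M)"
  show ?thesis
  proof (rule bij_betw_byWitness[where f' = ?dec])
    show "\<forall>z\<in>{- int k..int k} \<times> odd_interval j. ?dec (case z of (x, y) \<Rightarrow> (4 * int j + 4) * x + 1 * y) = z"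
    proof (rule ballI)
      fix z assume "z \<in> {- int k..int k} \<times> odd_interval j"
      then obtain x y where z: "z = (x, y)" and "y \<in> odd_interval j" by auto
      then have y: "0 \<le> y + M" "y + M < 2 * M" by (auto simp: odd_interval_def M_def)
      have eq: "(4 * int j + 4) * x + 1 * y + M = (2 * M) * x + (y + M)" by (simp add: M_def)
      show "?dec (case z of (x, y) \<Rightarrow> (4 * int j + 4) * x + 1 * y) = z"
        unfolding z prod.case using int_div_pos_eq[OF eq y] int_mod_pos_eq[OF eq y] by simp
    qed
    show "\<forall>h\<in>odd_interval (2 * j * k + j + 2 * k).
        (case ?dec h of (x, y) \<Rightarrow> (4 * int j + 4) * x + 1 * y) = h"
    proof
      fix h
      have "(4 * int j + 4) * x + 1 * (y - M) = h" if "2 * M * x + y = h + M" for x y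
        using that by (simp add: M_def)
      from this[OF mult_div_mod_eq]
      show "(case ?dec h of (x, y) \<Rightarrow> (4 * int j + 4) * x + 1 * y) = h"
        by (simp only: prod.case)
    qed
    show "(\<lambda>(x, y). (4 * int j + 4) * x + 1 * y) ` ({- int k..int k} \<times> odd_interval j)
        \<subseteq> odd_interval (2 * j * k + j + 2 * k)"
    proof clarify
      fix x y assume x: "x \<in> {- int k..int k}" and y: "y \<in> odd_interval j"
      have "\<bar>(2 * M) * x\<bar> \<le> 2 * M * int k"
        using x M by (auto simp: abs_mult intro!: mult_left_mono)
      moreover have "\<bar>y\<bar> \<le> M - 1" using y by (simp add: odd_interval_def J)
      ultimately have "\<bar>(2 * M) * x + y\<bar> \<le> 2 * M * int k + M - 1" by linarith
      moreover have "odd ((2 * M) * x + y)" using y by (simp add: odd_interval_def)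
      ultimately have "(2 * M) * x + y \<in> odd_interval (2 * j * k + j + 2 * k)"
        unfolding odd_interval_def N by simp
      then show "(4 * int j + 4) * x + 1 * y \<in> odd_interval (2 * j * k + j + 2 * k)"
        by (simp add: M_def)
    qed
    show "?dec ` odd_interval (2 * j * k + j + 2 * k) \<subseteq> {- int k..int k} \<times> odd_interval j"
    proof (rule image_subsetI)
      fix h assume h: "h \<in> odd_interval (2 * j * k + j + 2 * k)"
      define x where "x = (h + M) div (2 * M)"
      define y where "y = (h + M) mod (2 * M)"
      have xy: "(2 * M) * x + y = h + M" unfolding x_def y_def by (rule mult_div_mod_eq)
      have y: "0 \<le> y" "y < 2 * M" using M by (auto simp: y_def)
      have hb: "\<bar>h\<bar> \<le> 2 * M * int k + M - 1" "odd h"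
        using h by (auto simp: odd_interval_def N[symmetric])
      have "(2 * M) * x < (2 * M) * (int k + 1)" "(2 * M) * (- int k - 1) < (2 * M) * x"
        using xy y hb(1) M by (auto simp: algebra_simps)
      then have "x < int k + 1" "- int k - 1 < x"
        using M by (auto simp: mult_less_cancel_left)
      \<comment> \<open>Parity excludes the remainder 0, which would decode to \<open>- M\<close>,
        just outside \<open>odd_interval j\<close>.\<close>
      moreover have "odd y"
        using hb(2) \<open>even M\<close> arg_cong[OF xy, of even] by simp
      then have "y \<noteq> 0" by auto
      then have "y - M \<in> odd_interval j"
        using y \<open>odd y\<close> \<open>even M\<close> unfolding odd_interval_def J by auto
      ultimately show "?dec h \<in> {- int k..int k} \<times> odd_interval j"
        by (simp add: x_def y_def)
    qed
  qed
qed

text \<open>The centres \<open>(2j + 1)x\<close> with \<open>x\<close> odd are \<open>4j + 2\<close>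
  apart, and adding \<open>2y\<close> runs through the block of \<open>2j + 1\<close> odd numbers
  around each of them.\<close>

lemma bij_betw_odd_interval_interval:
  "bij_betw (\<lambda>(x, y). (2 * int j + 1) * x + 2 * y) (odd_interval k \<times> {- int j..int j})
     (odd_interval (2 * j * k + 2 * j + k))"
proof -
  define M where "M = 2 * int j + 1"
  have M: "0 < M" by (simp add: M_def)
  have N: "2 * int (2 * j * k + 2 * j + k) + 1 = M * (2 * int k + 2) - 1"
    by (simp add: M_def algebra_simps)
  have [simp]: "odd M" by (simp add: M_def)
  \<comment> \<open>With \<open>x = 2x' + 1\<close> the encoded value is
    \<open>2(M x' + (y + j)) + 1\<close>, so half of it, rounded down, has quotient
    \<open>x'\<close> and remainder \<open>y + j\<close> modulo \<open>M\<close>.\<close>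
  let ?dec = "\<lambda>h. (2 * (h div 2 div M) + 1, h div 2 mod M - int j)"
  show ?thesis
    unfolding M_def[symmetric]
  proof (rule bij_betw_byWitness[where f' = ?dec])
    show "\<forall>z\<in>odd_interval k \<times> {- int j..int j}. ?dec (case z of (x, y) \<Rightarrow> M * x + 2 * y) = z"
    proof (rule ballI)
      fix z assume "z \<in> odd_interval k \<times> {- int j..int j}"
      then obtain x y where z: "z = (x, y)" and "x \<in> odd_interval k" and y: "y \<in> {- int j..int j}"
        by auto
      then obtain x' where x: "x = 2 * x' + 1" by (auto simp: odd_interval_def elim: oddE)
      have "M * x + 2 * y = 2 * ((y + int j) + M * x') + 1" by (simp add: M_def x algebra_simps)
      then have eq: "(M * x + 2 * y) div 2 = M * x' + (y + int j)" by presburger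
      have "0 \<le> y + int j" "y + int j < M" using y by (auto simp: M_def)
      note int_div_pos_eq[OF eq this] int_mod_pos_eq[OF eq this]
      then show "?dec (case z of (x, y) \<Rightarrow> M * x + 2 * y) = z"
        unfolding z x prod.case by simp
    qed
    show "\<forall>h\<in>odd_interval (2 * j * k + 2 * j + k). (case ?dec h of (x, y) \<Rightarrow> M * x + 2 * y) = h"
    proof
      fix h assume "h \<in> odd_interval (2 * j * k + 2 * j + k)"
      then have "h = 2 * (h div 2) + 1" by (simp add: odd_interval_def)
      also have "h div 2 = M * (h div 2 div M) + h div 2 mod M"
        by (rule mult_div_mod_eq[symmetric])
      also have "2 * (M * x + y) + 1 = M * (2 * x + 1) + 2 * (y - int j)" for x y
        by (simp add: M_def algebra_simps)
      finally show "(case ?dec h of (x, y) \<Rightarrow> M * x + 2 * y) = h" by simp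
    qed
    show "(\<lambda>(x, y). M * x + 2 * y) ` (odd_interval k \<times> {- int j..int j})
        \<subseteq> odd_interval (2 * j * k + 2 * j + k)"
    proof clarify
      fix x y assume x: "x \<in> odd_interval k" and y: "y \<in> {- int j..int j}"
      have "\<bar>M * x\<bar> \<le> M * (2 * int k + 1)"
        using x M by (auto simp: abs_mult odd_interval_def intro!: mult_left_mono)
      moreover have "\<bar>2 * y\<bar> \<le> M - 1" using y by (auto simp: M_def)
      ultimately have "\<bar>M * x + 2 * y\<bar> \<le> M * (2 * int k + 2) - 1" by (simp add: algebra_simps)
      moreover have "odd (M * x + 2 * y)" using x by (simp add: odd_interval_def)
      ultimately show "M * x + 2 * y \<in> odd_interval (2 * j * k + 2 * j + k)"
        unfolding odd_interval_def N by simp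
    qed
    show "?dec ` odd_interval (2 * j * k + 2 * j + k) \<subseteq> odd_interval k \<times> {- int j..int j}"
    proof (rule image_subsetI)
      fix h assume h: "h \<in> odd_interval (2 * j * k + 2 * j + k)"
      define x where "x = h div 2 div M"
      define y where "y = h div 2 mod M"
      have xy: "M * x + y = h div 2" unfolding x_def y_def by (rule mult_div_mod_eq)
      have y: "0 \<le> y" "y < M" using M by (auto simp: y_def)
      have "\<bar>h\<bar> \<le> M * (2 * int k + 2) - 1" and "h = 2 * (h div 2) + 1"
        using h by (auto simp: odd_interval_def N[symmetric])
      \<comment> \<open>Rounding down makes the range asymmetric: the quotient \<open>x\<close> runs
        from \<open>- k - 1\<close> to \<open>k\<close>, so \<open>2x + 1\<close> is symmetric
        again.\<close>
      then have "h div 2 < M * (int k + 1)" "- (M * (int k + 1)) \<le> h div 2"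
        by (auto simp: algebra_simps)
      then have "M * x < M * (int k + 1)" "M * (- int k - 2) < M * x"
        using xy y M by (auto simp: algebra_simps)
      then have "x < int k + 1" "- int k - 2 < x"
        using M by (auto simp: mult_less_cancel_left)
      then have "2 * x + 1 \<in> odd_interval k"
        by (auto simp: odd_interval_def)
      moreover have "y - int j \<in> {- int j..int j}"
        using y by (auto simp: M_def)
      ultimately show "?dec h \<in> odd_interval k \<times> {- int j..int j}"
        by (simp add: x_def y_def)
    qed
  qed
qed

section \<open>The coefficient identities and the theorem\<close>

text \<open>Odd values for \<open>\<sigma>\<close> produce \<open>des_A\<close>, interval values for
  \<open>\<tau>\<close> produce \<open>des_B\<close>, and the first tiling encodes the pairs as odd
  values for \<open>w\<close>.\<close>

lemma binomial_factorizations_des_A_des_B: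
  assumes w: "w \<in> hyperoctahedral n"
  shows "(2 * j * k + j + 2 * k + n - des_A n w) choose n
    = (\<Sum>(\<sigma>, \<tau>)\<in>factorizations n w. (j + n - des_A n \<sigma> choose n) * (k + n - des_B n \<tau> choose n))"
proof -
  have "card (odd_seqs n w (odd_interval (2 * j * k + j + 2 * k)))
      = (\<Sum>(\<sigma>, \<tau>)\<in>factorizations n w.
          card (odd_seqs n \<sigma> (odd_interval j)) * card (odd_seqs n \<tau> {- int k..int k}))"
  proof (rule card_odd_seqs_factorizations[OF w _ _ _ bij_betw_interval_odd_interval])
    fix x y x' y' assume m: "(x, y) \<in> insert (0, 0) ({- int k..int k} \<times> odd_interval j)"
      "(x', y') \<in> insert (0, 0) ({- int k..int k} \<times> odd_interval j)" and "x < x'"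
    \<comment> \<open>A gap of at least \<open>4j + 4\<close> exceeds the difference of second
      components, at most \<open>4j + 2\<close>.\<close>
    have "(4 * int j + 4) * (x + 1) \<le> (4 * int j + 4) * x'"
      using \<open>x < x'\<close> by (intro mult_left_mono) auto
    moreover have "y \<le> 2 * int j + 1" "- (2 * int j + 1) \<le> y'"
      using m by (auto simp: odd_interval_def)
    ultimately show "(4 * int j + 4) * x + 1 * y < (4 * int j + 4) * x' + 1 * y'"
      by (simp add: algebra_simps)
  next
    show "- x \<in> odd_interval j" if "x \<in> odd_interval j" for x
      using that by (simp add: odd_interval_def)
  qed (auto simp: card_odd_seqs_odd_interval card_odd_seqs_interval)
  also have "\<dots> = (\<Sum>(\<sigma>, \<tau>)\<in>factorizations n w.
      (j + n - des_A n \<sigma> choose n) * (k + n - des_B n \<tau> choose n))"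
    by (intro sum.cong) (auto simp: factorizations_def card_odd_seqs_odd_interval card_odd_seqs_interval)
  finally show ?thesis
    by (simp add: card_odd_seqs_odd_interval[OF w])
qed

text \<open>The value sets change places, so the second tiling is used.\<close>

lemma binomial_factorizations_des_B_des_A:
  assumes w: "w \<in> hyperoctahedral n"
  shows "(2 * j * k + 2 * j + k + n - des_A n w) choose n
    = (\<Sum>(\<sigma>, \<tau>)\<in>factorizations n w. (j + n - des_B n \<sigma> choose n) * (k + n - des_A n \<tau> choose n))"
proof -
  have "card (odd_seqs n w (odd_interval (2 * j * k + 2 * j + k)))
      = (\<Sum>(\<sigma>, \<tau>)\<in>factorizations n w.
          card (odd_seqs n \<sigma> {- int j..int j}) * card (odd_seqs n \<tau> (odd_interval k)))"
  proof (rule card_odd_seqs_factorizations[OF w _ _ _ bij_betw_odd_interval_interval])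
    fix x y x' y' assume m: "(x, y) \<in> insert (0, 0) (odd_interval k \<times> {- int j..int j})"
      "(x', y') \<in> insert (0, 0) (odd_interval k \<times> {- int j..int j})" and "x < x'"
    have y: "y \<le> int j" "- int j \<le> y'" using m by auto
    show "(2 * int j + 1) * x + 2 * y < (2 * int j + 1) * x' + 2 * y'"
    proof (cases "x' = x + 1")
      case True
      \<comment> \<open>First components other than that of \<open>(0, 0)\<close> are odd, so
        neighbouring ones involve \<open>(0, 0)\<close>. One second component is then 0, and the gap
        \<open>2j + 1\<close> suffices.\<close>
      then have "x = 0 \<and> y = 0 \<or> x' = 0 \<and> y' = 0"
        using m by (auto simp: odd_interval_def)
      then show ?thesis using y True by (auto simp: algebra_simps)
    next
      case False
      \<comment> \<open>Otherwise the gap is at least \<open>4j + 2\<close>, while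
        \<open>2 * y\<close> and \<open>2 * y'\<close> differ by at most \<open>4j\<close>.\<close>
      then have "(2 * int j + 1) * (x + 2) \<le> (2 * int j + 1) * x'"
        using \<open>x < x'\<close> by (intro mult_left_mono) auto
      then show ?thesis
        using y by (simp add: algebra_simps)
    qed
  qed (auto simp: card_odd_seqs_odd_interval card_odd_seqs_interval)
  also have "\<dots> = (\<Sum>(\<sigma>, \<tau>)\<in>factorizations n w.
      (j + n - des_B n \<sigma> choose n) * (k + n - des_A n \<tau> choose n))"
    by (intro sum.cong) (auto simp: factorizations_def card_odd_seqs_odd_interval card_odd_seqs_interval)
  finally show ?thesis
    by (simp add: card_odd_seqs_odd_interval[OF w])
qed

lemma des_B_le: "des_B n w \<le> n"
proof -
  have "des_B n w \<le> card {0..int n - 1}"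
    unfolding des_B_def by (rule card_mono) auto
  then show ?thesis by simp
qed

theorem theorem2p7p3:
  fixes n :: nat and \<pi> :: "int \<Rightarrow> int"
  assumes "n \<ge> 1" and "\<pi> \<in> hyperoctahedral n"
  shows "double_series (\<lambda>j k. of_nat ((2 * j * k + j + 2 * k + n - des_A n \<pi>) choose n)) =
           (\<Sum>(\<sigma>, \<tau>)\<in>factorizations n \<pi>. var_s ^ des_A n \<sigma> * var_t ^ des_B n \<tau>) /
           ((1 - var_s) ^ (n + 1) * (1 - var_t) ^ (n + 1)) \<and>
         double_series (\<lambda>j k. of_nat ((2 * j * k + 2 * j + k + n - des_A n \<pi>) choose n)) =
           (\<Sum>(\<sigma>, \<tau>)\<in>factorizations n \<pi>. var_s ^ des_B n \<sigma> * var_t ^ des_A n \<tau>) /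
           ((1 - var_s) ^ (n + 1) * (1 - var_t) ^ (n + 1))"
proof
  have "(of_nat ((2 * j * k + j + 2 * k + n - des_A n \<pi>) choose n) :: rat)
      = (\<Sum>z\<in>factorizations n \<pi>. of_nat (j + n - des_A n (fst z) choose n) * of_nat (k + n - des_B n (snd z) choose n))"
    for j k
    unfolding binomial_factorizations_des_A_des_B[OF assms(2)] by (simp add: case_prod_beta)
  from double_series_eq_divide[OF finite_factorizations des_A_le des_B_le this]
  show "double_series (\<lambda>j k. of_nat ((2 * j * k + j + 2 * k + n - des_A n \<pi>) choose n)) =
      (\<Sum>(\<sigma>, \<tau>)\<in>factorizations n \<pi>. var_s ^ des_A n \<sigma> * var_t ^ des_B n \<tau>) /
      ((1 - var_s) ^ (n + 1) * (1 - var_t) ^ (n + 1))"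
    unfolding case_prod_beta .
next
  have "(of_nat ((2 * j * k + 2 * j + k + n - des_A n \<pi>) choose n) :: rat)
      = (\<Sum>z\<in>factorizations n \<pi>. of_nat (j + n - des_B n (fst z) choose n) * of_nat (k + n - des_A n (snd z) choose n))"
    for j k
    unfolding binomial_factorizations_des_B_des_A[OF assms(2)] by (simp add: case_prod_beta)
  from double_series_eq_divide[OF finite_factorizations des_B_le des_A_le this]
  show "double_series (\<lambda>j k. of_nat ((2 * j * k + 2 * j + k + n - des_A n \<pi>) choose n)) =
      (\<Sum>(\<sigma>, \<tau>)\<in>factorizations n \<pi>. var_s ^ des_B n \<sigma> * var_t ^ des_A n \<tau>) /
      ((1 - var_s) ^ (n + 1) * (1 - var_t) ^ (n + 1))"
    unfolding case_prod_beta .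
qed

end
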